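(* Let $f\colon\{0,1\}^n\to\{0,1,\perp\}$ be a partial function and $F(x,y)=f(x\oplus y)$. If $f$ is undefined on fewer than $2^{n-3}$ inputs and $\mathrm{D_{cc}^{\rightarrow}}(F)=2$, then $\mathrm{NADT^{\oplus}}(f)=2$.
   Context: $f$ is undefined at $x$ if $f(x)=\perp$; $\operatorname{Dom}(f)=f^{-1}(\{0,1\})$, $\oplus$ is bitwise XOR, $\operatorname{Dom}(F)=\{(x,y):x\oplus y\in\operatorname{Dom}(f)\}$. $\mathrm{D_{cc}^{\rightarrow}}(F)$ is the minimum $t$ such that there are total $h\colon\{0,1\}^n\to\{0,1\}^t$ and $\varphi\colon\{0,1\}^t\times\{0,1\}^n\to\{0,1\}$ with $\varphi(h(x),y)=F(x,y)$ for all $(x,y)\in\operatorname{Dom}(F)$. With $\langle s,x\rangle=\bigoplus_is_i\wedge x_i$, $\mathrm{NADT^{\oplus}}(f)$ is the minimum $p$ such that there are $s_1,\dots,s_p\in\{0,1\}^n$ and total $l\colon\{0,1\}^p\to\{0,1\}$ with $l(\langle s_1,x\rangle,\dots,\langle s_p,x\rangle)=f(x)$ for all $x\in\operatorname{Dom}(f)$. *)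

theory Defs
  imports Complex_Main
begin

text \<open>
  Bit strings are Boolean lists with \<^term>\<open>True\<close> for 1. A partial Boolean function is option-valued,
  with \<^term>\<open>None\<close> for the undefined value; only its values on strings of length \<open>n\<close> matter.
\<close>

definition cube :: "nat \<Rightarrow> bool list set" where
  "cube n = {x. length x = n}"

definition bxor :: "bool list \<Rightarrow> bool list \<Rightarrow> bool list" (infixl "\<oplus>" 65) where
  "x \<oplus> y = map2 (\<noteq>) x y"

definition parity :: "bool list \<Rightarrow> bool list \<Rightarrow> bool" where
  "parity s x = foldr (\<noteq>) (map2 (\<and>) s x) False"

definition oneway_protocol ::
    "nat \<Rightarrow> (bool list \<Rightarrow> bool list \<Rightarrow> bool option) \<Rightarrow> nat \<Rightarrow> bool" where
  "oneway_protocol n F t \<longleftrightarrow>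
     (\<exists>(h :: bool list \<Rightarrow> bool list) (\<phi> :: bool list \<Rightarrow> bool list \<Rightarrow> bool).
        h ` cube n \<subseteq> cube t \<and>
        (\<forall>x\<in>cube n. \<forall>y\<in>cube n. F x y \<noteq> None \<longrightarrow> Some (\<phi> (h x) y) = F x y))"

definition Dcc_oneway :: "nat \<Rightarrow> (bool list \<Rightarrow> bool list \<Rightarrow> bool option) \<Rightarrow> nat" where
  "Dcc_oneway n F = (LEAST t. oneway_protocol n F t)"

definition parity_nadt :: "nat \<Rightarrow> (bool list \<Rightarrow> bool option) \<Rightarrow> nat \<Rightarrow> bool" where
  "parity_nadt n f p \<longleftrightarrow>
     (\<exists>(ss :: bool list list) (l :: bool list \<Rightarrow> bool).
        length ss = p \<and> set ss \<subseteq> cube n \<and>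
        (\<forall>x\<in>cube n. f x \<noteq> None \<longrightarrow> Some (l (map (\<lambda>s. parity s x) ss)) = f x))"

definition NADT_parity :: "nat \<Rightarrow> (bool list \<Rightarrow> bool option) \<Rightarrow> nat" where
  "NADT_parity n f = (LEAST p. parity_nadt n f p)"

end

theory Submission
  imports Defs
begin

text \<open>
  Let \<open>N = 2 ^ n\<close>, let \<open>D\<close> be the set of shifts \<open>d\<close> such that \<open>f z\<close> and \<open>f (z \<oplus> d)\<close> never conflict, and
  let \<open>C\<close> be its complement. A parity decision tree of depth 2 is a subspace of codimension at most 2
  inside \<open>D\<close>, while a one-way protocol with 2 bits is a colouring of the cube by 4 colours in which
  two points of the same colour differ by an element of \<open>D\<close>. If \<open>d \<in> C\<close> is witnessed by \<open>z\<close> and both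
  \<open>a\<close> and \<open>a \<oplus> d\<close> are in \<open>D\<close>, then \<open>f\<close> is undefined at \<open>z \<oplus> a\<close>; hence \<open>D\<close> meets each of its translates by
  elements of \<open>C\<close> in fewer than \<open>N / 8\<close> points.

  If \<open>C\<close> is sum-free, this makes \<open>C\<close> so large that \<open>C \<oplus> C\<close> is a subspace inside \<open>D\<close>. Otherwise take
  \<open>a\<close>, \<open>b\<close>, \<open>a \<oplus> b\<close> in \<open>C\<close>. Every coset of \<open>P = {0, a, b, a \<oplus> b}\<close> contains each colour exactly once, and by
  counting, more than \<open>N / 16\<close> cosets of \<open>P\<close> meet \<open>D\<close> in a single point \<open>z\<close>. Translation by such a \<open>z\<close> must
  preserve the colouring, so the stabiliser \<open>H\<close> of the colouring has more than \<open>N / 16\<close> elements. If it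
  is too small, a colour class, having \<open>N / 4\<close> points, contains a further coset of \<open>H\<close>, and adding it
  to \<open>H\<close> gives the required subspace.
\<close>

section \<open>XOR as the group operation of the cube, and translates of sets\<close>

lemma bxor_in_cube [simp]: "x \<in> cube n \<Longrightarrow> y \<in> cube n \<Longrightarrow> x \<oplus> y \<in> cube n"
  by (simp add: cube_def bxor_def)

lemma bxor_commute: "x \<oplus> y = y \<oplus> x"
  unfolding bxor_def by (induction x y rule: list_induct2') auto

lemma bxor_assoc: "(x \<oplus> y) \<oplus> z = x \<oplus> (y \<oplus> z)"
proof (induction x arbitrary: y z)
  case Nil
  then show ?case by (simp add: bxor_def)
next
  case (Cons a x)
  then show ?case by (cases y; cases z) (auto simp: bxor_def)
qed

lemma bxor_left_commute: "x \<oplus> (y \<oplus> z) = y \<oplus> (x \<oplus> z)"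
  by (metis bxor_assoc bxor_commute)

lemmas bxor_ac = bxor_assoc bxor_commute bxor_left_commute

definition zeros :: "nat \<Rightarrow> bool list" where
  "zeros n = replicate n False"

lemma zeros_in_cube [simp]: "zeros n \<in> cube n"
  by (simp add: cube_def zeros_def)

lemma bxor_self: "x \<in> cube n \<Longrightarrow> x \<oplus> x = zeros n"
  unfolding cube_def bxor_def zeros_def by (induction x arbitrary: n) auto

lemma bxor_zeros: "x \<in> cube n \<Longrightarrow> x \<oplus> zeros n = x"
  unfolding cube_def bxor_def zeros_def by (induction x arbitrary: n) auto

lemma bxor_zeros_left: "x \<in> cube n \<Longrightarrow> zeros n \<oplus> x = x"
  by (metis bxor_commute bxor_zeros)

lemma bxor_cancel: "x \<in> cube n \<Longrightarrow> y \<in> cube n \<Longrightarrow> x \<oplus> (x \<oplus> y) = y"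
  by (metis bxor_assoc bxor_self bxor_zeros_left)

lemma bxor_cancel_right: "x \<in> cube n \<Longrightarrow> y \<in> cube n \<Longrightarrow> (y \<oplus> x) \<oplus> x = y"
  by (metis bxor_assoc bxor_self bxor_zeros)

lemma cube_0: "cube 0 = {[]}"
  by (auto simp: cube_def)

lemma finite_cube [simp]: "finite (cube n)"
  using finite_lists_length_eq[of "UNIV :: bool set" n] by (simp add: cube_def)

lemma card_cube: "card (cube n) = 2 ^ n"
  using card_lists_length_eq[of "UNIV :: bool set" n] by (simp add: cube_def)

lemma inj_on_bxor: "a \<in> cube n \<Longrightarrow> inj_on ((\<oplus>) a) (cube n)"
  by (rule inj_onI) (metis bxor_cancel)

lemma card_translate:
  assumes "a \<in> cube n" "S \<subseteq> cube n"
  shows "card ((\<oplus>) a ` S) = card S"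
  by (meson assms card_image inj_on_bxor inj_on_subset)

lemma mem_translate_iff:
  assumes "a \<in> cube n" "S \<subseteq> cube n" "x \<in> cube n"
  shows "x \<in> (\<oplus>) a ` S \<longleftrightarrow> a \<oplus> x \<in> S"
proof
  assume "x \<in> (\<oplus>) a ` S"
  then show "a \<oplus> x \<in> S" using assms bxor_cancel by auto
next
  assume "a \<oplus> x \<in> S"
  then show "x \<in> (\<oplus>) a ` S" by (metis assms(1,3) bxor_cancel imageI)
qed

section \<open>Subspaces of the cube and the parities that cut them out\<close>

text \<open>The only scalars are 0 and 1, so closure under addition together with the zero string is
  full linearity.\<close>

definition subspace_of_cube :: "nat \<Rightarrow> bool list set \<Rightarrow> bool" where
  "subspace_of_cube n G \<longleftrightarrow>
     G \<subseteq> cube n \<and> zeros n \<in> G \<and> (\<forall>x\<in>G. \<forall>y\<in>G. x \<oplus> y \<in> G)"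

lemma subspace_of_cube_translate:
  assumes G: "subspace_of_cube n G" and v: "v \<in> cube n"
  shows "subspace_of_cube n (G \<union> (\<oplus>) v ` G)"
proof -
  have sub: "G \<subseteq> cube n" and z: "zeros n \<in> G" and cl: "\<And>x y. x \<in> G \<Longrightarrow> y \<in> G \<Longrightarrow> x \<oplus> y \<in> G"
    using G by (auto simp: subspace_of_cube_def)
  have 1: "x \<oplus> (v \<oplus> y) \<in> (\<oplus>) v ` G" if "x \<in> G" "y \<in> G" for x y
    using cl[OF that] by (simp add: bxor_left_commute)
  have 2: "(v \<oplus> x) \<oplus> y \<in> (\<oplus>) v ` G" if "x \<in> G" "y \<in> G" for x y
    using cl[OF that] by (simp add: bxor_assoc)
  have 3: "(v \<oplus> x) \<oplus> (v \<oplus> y) \<in> G" if "x \<in> G" "y \<in> G" for x y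
  proof -
    have "(v \<oplus> x) \<oplus> (v \<oplus> y) = v \<oplus> (v \<oplus> (x \<oplus> y))"
      by (simp add: bxor_ac)
    also have "\<dots> = x \<oplus> y" using sub that v by (intro bxor_cancel bxor_in_cube) auto
    finally show ?thesis using cl[OF that] by simp
  qed
  show ?thesis
    unfolding subspace_of_cube_def using sub z cl v 1 2 3 by auto
qed

lemma card_subspace_translate:
  assumes G: "subspace_of_cube n G" and v: "v \<in> cube n" "v \<notin> G"
  shows "card (G \<union> (\<oplus>) v ` G) = 2 * card G"
proof -
  have sub: "G \<subseteq> cube n" and cl: "\<And>x y. x \<in> G \<Longrightarrow> y \<in> G \<Longrightarrow> x \<oplus> y \<in> G"
    using G by (auto simp: subspace_of_cube_def)
  have "v \<oplus> x \<notin> G" if "x \<in> G" for x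
    using cl[of "v \<oplus> x" x] that v sub by (metis bxor_cancel_right subsetD)
  then have "G \<inter> (\<oplus>) v ` G = {}" by auto
  moreover have "finite G" using sub finite_cube finite_subset by blast
  ultimately show ?thesis
    using card_translate[OF v(1) sub] by (simp add: card_Un_disjoint)
qed

text \<open>Induction on \<open>n\<close>: restricting \<open>g\<close> to strings that start with
  \<open>False\<close> gives the tail of \<open>s\<close>, and the value of \<open>g\<close> at the
  first unit vector is its head.\<close>

lemma additive_is_parity:
  assumes "\<And>x y. x \<in> cube n \<Longrightarrow> y \<in> cube n \<Longrightarrow> g (x \<oplus> y) = (g x \<noteq> g y)"
  shows "\<exists>s\<in>cube n. \<forall>x\<in>cube n. g x = parity s x"
  using assms
proof (induction n arbitrary: g)
  case 0
  have "\<not> g []" using 0[of "[]" "[]"] by (auto simp: cube_0 bxor_def)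
  then show ?case by (auto simp: cube_0 parity_def)
next
  case (Suc n)
  have add: "g (False # (x \<oplus> y)) = (g (False # x) \<noteq> g (False # y))"
    if "x \<in> cube n" "y \<in> cube n" for x y
    using Suc.prems[of "False # x" "False # y"] that by (simp add: cube_def bxor_def)
  obtain s where s: "s \<in> cube n" "\<forall>x\<in>cube n. g (False # x) = parity s x"
    using Suc.IH[of "\<lambda>x. g (False # x)"] add by blast
  define b where "b = g (True # zeros n)"
  have True_case: "g (True # x) = (b \<noteq> g (False # x))" if "x \<in> cube n" for x
  proof -
    have "(True # zeros n) \<oplus> (False # x) = True # x"
      using bxor_zeros_left[OF that] by (simp add: bxor_def)
    then show ?thesis
      using Suc.prems[of "True # zeros n" "False # x"] that
      by (simp add: b_def cube_def zeros_def)
  qed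
  have "g x = parity (b # s) x" if x: "x \<in> cube (Suc n)" for x
  proof -
    obtain c y where "x = c # y" "y \<in> cube n"
      using x by (cases x) (auto simp: cube_def)
    then show ?thesis
      using s(2) True_case[of y] by (cases c) (auto simp: parity_def)
  qed
  moreover have "b # s \<in> cube (Suc n)" using s(1) by (simp add: cube_def)
  ultimately show ?case by blast
qed

lemma parity_bxor:
  assumes "s \<in> cube n" "x \<in> cube n" "y \<in> cube n"
  shows "parity s (x \<oplus> y) = (parity s x \<noteq> parity s y)"
proof -
  have "length s = length x" "length x = length y" using assms by (auto simp: cube_def)
  then show ?thesis
    by (induction s x y rule: list_induct3) (auto simp: parity_def bxor_def)
qed

text \<open>When \<open>G\<close> has at most two cosets, two points outside \<open>G\<close> have
  their sum in \<open>G\<close>, so being outside \<open>G\<close> is an additive function.\<close>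

lemma index_two_parity:
  assumes G: "subspace_of_cube n G" and cov: "cube n \<subseteq> G \<union> (\<oplus>) v ` G" and v: "v \<in> cube n"
  shows "\<exists>s\<in>cube n. \<forall>x\<in>cube n. parity s x \<longleftrightarrow> x \<notin> G"
proof -
  have sub: "G \<subseteq> cube n" and cl: "\<And>x y. x \<in> G \<Longrightarrow> y \<in> G \<Longrightarrow> x \<oplus> y \<in> G"
    using G by (auto simp: subspace_of_cube_def)
  have "(x \<oplus> y \<notin> G) = ((x \<notin> G) \<noteq> (y \<notin> G))" if xy: "x \<in> cube n" "y \<in> cube n" for x y
  proof -
    have 1: "x \<oplus> y \<notin> G" if "x \<in> G" "y \<notin> G"
      using cl[of x "x \<oplus> y"] that xy bxor_cancel by auto
    have 2: "x \<oplus> y \<notin> G" if "x \<notin> G" "y \<in> G"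
      using cl[of "x \<oplus> y" y] that xy bxor_cancel_right by auto
    have 3: "x \<oplus> y \<in> G" if "x \<notin> G" "y \<notin> G"
    proof -
      have "x \<in> (\<oplus>) v ` G" "y \<in> (\<oplus>) v ` G" using cov xy that by auto
      then obtain x' y' where e: "x = v \<oplus> x'" "y = v \<oplus> y'" "x' \<in> G" "y' \<in> G"
        by blast
      have "x \<oplus> y = v \<oplus> (v \<oplus> (x' \<oplus> y'))" unfolding e by (simp add: bxor_ac)
      also have "\<dots> = x' \<oplus> y'" using sub e v by (intro bxor_cancel bxor_in_cube) auto
      finally show ?thesis using cl e by simp
    qed
    show ?thesis using 1 2 3 cl by blast
  qed
  then show ?thesis using additive_is_parity[of n "\<lambda>x. x \<notin> G"] by metis
qed

text \<open>Adjoining a new vector doubles a subspace, and three doublings of \<open>G\<close> would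
  exceed the cube. So at most two are possible, and \<open>G\<close> is the whole cube, has index 2,
  or is the intersection of two subspaces of index 2.\<close>

lemma two_parities_kernel_subset:
  assumes G: "subspace_of_cube n G" and big: "2 ^ n < 8 * card G"
  shows "\<exists>s\<in>cube n. \<exists>t\<in>cube n. \<forall>x\<in>cube n. \<not> parity s x \<longrightarrow> \<not> parity t x \<longrightarrow> x \<in> G"
proof -
  have sub: "G \<subseteq> cube n" using G by (simp add: subspace_of_cube_def)
  have le: "card K \<le> 2 ^ n" if "subspace_of_cube n K" for K
    using that card_mono[OF finite_cube, of K n] by (simp add: subspace_of_cube_def card_cube)
  consider (top) "cube n \<subseteq> G"
    | (half) v where "v \<in> cube n" "v \<notin> G" "cube n \<subseteq> G \<union> (\<oplus>) v ` G"
    | (quarter) v w where "v \<in> cube n" "v \<notin> G" "w \<in> cube n" "w \<notin> G \<union> (\<oplus>) v ` G"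
    by blast
  then show ?thesis
  proof cases
    case top
    then show ?thesis using zeros_in_cube by blast
  next
    case half
    then show ?thesis using index_two_parity[OF G] by blast
  next
    case quarter
    define K where "K = G \<union> (\<oplus>) v ` G"
    define L where "L = G \<union> (\<oplus>) w ` G"
    define M where "M = K \<union> (\<oplus>) w ` K"
    have K: "subspace_of_cube n K" and L: "subspace_of_cube n L"
      using subspace_of_cube_translate G quarter by (auto simp: K_def L_def)
    have M: "subspace_of_cube n M" using subspace_of_cube_translate K quarter by (auto simp: M_def)
    have cK: "card K = 2 * card G" and cM: "card M = 2 * card K"
      unfolding M_def K_def using card_subspace_translate G K quarter by (auto simp: K_def)
    have top: "cube n \<subseteq> M"
    proof
      fix u assume u: "u \<in> cube n"
      show "u \<in> M"
      proof (rule ccontr)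
        assume "u \<notin> M"
        then have "card (M \<union> (\<oplus>) u ` M) = 2 * card M"
          using card_subspace_translate[OF M u] by simp
        then show False using le[OF subspace_of_cube_translate[OF M u]] big cK cM by simp
      qed
    qed
    \<comment> \<open>\<open>M\<close> is symmetric in \<open>v\<close> and \<open>w\<close>, so
      \<open>L\<close> has at most two cosets, just as \<open>K\<close> does.\<close>
    have "M = L \<union> (\<oplus>) v ` L"
      unfolding M_def K_def L_def by (auto simp: image_Un image_image bxor_left_commute)
    then obtain t where t: "t \<in> cube n" "\<forall>x\<in>cube n. parity t x \<longleftrightarrow> x \<notin> L"
      using index_two_parity[OF L] quarter top by blast
    obtain s where s: "s \<in> cube n" "\<forall>x\<in>cube n. parity s x \<longleftrightarrow> x \<notin> K"
      using index_two_parity[OF K] quarter top unfolding M_def by blast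
    \<comment> \<open>A point of \<open>L\<close> outside \<open>G\<close> is \<open>w\<close> plus
      an element of \<open>G\<close>; if it were also in \<open>K\<close>, so would be
      \<open>w\<close>.\<close>
    have "x \<in> G" if "x \<in> K" "x \<in> L" for x
    proof (rule ccontr)
      assume "x \<notin> G"
      then obtain g where g: "g \<in> G" "x = w \<oplus> g" using \<open>x \<in> L\<close> by (auto simp: L_def)
      then have "x \<oplus> g \<in> K" using K \<open>x \<in> K\<close> by (auto simp: subspace_of_cube_def K_def)
      moreover have "x \<oplus> g = w" using g quarter sub bxor_cancel_right by auto
      ultimately show False using quarter by (simp add: K_def)
    qed
    then show ?thesis using s t by blast
  qed
qed

section \<open>Large subspaces inside a set that meets many of its translates in few points\<close>

text \<open>Each \<open>w\<close> in \<open>C \<oplus> C\<close> satisfies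
  \<open>x \<oplus> w \<in> C\<close> for all but at most \<open>u\<close> of the \<open>x\<close>
  in \<open>C\<close>. As \<open>card C > 2 * u\<close>, any two such \<open>w\<close> share an
  \<open>x\<close>, which writes their sum as a sum of two elements of \<open>C\<close>.\<close>

lemma subspace_in_popular_set_triangle_free:
  assumes D: "D \<subseteq> cube n"
    and pop: "\<And>d. d \<in> cube n - D \<Longrightarrow> card {a \<in> D. a \<oplus> d \<in> D} \<le> u"
    and u: "8 * u < 2 ^ n"
    and c: "c \<in> cube n - D"
    and tf: "\<And>a b. a \<in> cube n - D \<Longrightarrow> b \<in> cube n - D \<Longrightarrow> a \<oplus> b \<in> D"
  shows "\<exists>G. subspace_of_cube n G \<and> G \<subseteq> D \<and> 2 ^ n < 8 * card G"
proof -
  define C where "C = cube n - D"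
  define G where "G = {a \<oplus> b | a b. a \<in> C \<and> b \<in> C}"
  have C: "C \<subseteq> cube n" and finC: "finite C" by (auto simp: C_def)
  have finD: "finite D" using D finite_cube finite_subset by blast
  have GI: "a \<oplus> b \<in> G" if "a \<in> C" "b \<in> C" for a b using that by (auto simp: G_def)
  have GD: "G \<subseteq> D" using tf by (auto simp: G_def C_def)
  have cC: "c \<in> C" "c \<in> cube n" using c by (auto simp: C_def)
  have "card (cube n) = card C + card D"
    unfolding C_def using D finD by (simp add: card_Diff_subset card_mono)
  then have N: "card C + card D = 2 ^ n" by (simp add: card_cube)
  \<comment> \<open>Shifting a point of \<open>D\<close> by \<open>c\<close> either stays in
    \<open>D\<close>, which happens at most \<open>u\<close> times, or lands in
    \<open>C\<close>.\<close>
  have "D \<subseteq> {a \<in> D. a \<oplus> c \<in> D} \<union> (\<oplus>) c ` C"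
  proof
    fix x assume x: "x \<in> D"
    then have "x \<in> cube n" using D by auto
    then show "x \<in> {a \<in> D. a \<oplus> c \<in> D} \<union> (\<oplus>) c ` C"
      using x cC C mem_translate_iff[of c n C x] by (auto simp: C_def bxor_commute)
  qed
  then have "card D \<le> card ({a \<in> D. a \<oplus> c \<in> D} \<union> (\<oplus>) c ` C)"
    using finD finC by (intro card_mono) auto
  also have "\<dots> \<le> u + card C"
    using card_Un_le[of "{a \<in> D. a \<oplus> c \<in> D}" "(\<oplus>) c ` C"] pop[OF c] card_translate[OF cC(2) C]
    by simp
  finally have DC: "card D \<le> u + card C" .
  \<comment> \<open>By sum-freeness the translates of \<open>C\<close> by \<open>a\<close> and by
    \<open>b\<close> both lie in \<open>D\<close>, which has at most \<open>u\<close> elements more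
    than \<open>C\<close>, so they overlap in all but \<open>u\<close> points at most.\<close>
  have popC: "card C \<le> card {x \<in> C. x \<oplus> w \<in> C} + u" if w: "w \<in> G" for w
  proof -
    obtain a b where ab: "w = a \<oplus> b" "a \<in> C" "b \<in> C" using w by (auto simp: G_def)
    have abc: "a \<in> cube n" "b \<in> cube n" using ab C by auto
    let ?A = "(\<oplus>) a ` C" and ?B = "(\<oplus>) b ` C"
    have "?A \<union> ?B \<subseteq> D" using ab tf by (auto simp: C_def)
    then have "card (?A \<union> ?B) \<le> card D" using finD by (rule card_mono[rotated])
    moreover have "card ?A + card ?B = card (?A \<union> ?B) + card (?A \<inter> ?B)"
      using finC by (intro card_Un_Int) auto
    ultimately have "2 * card C \<le> card D + card (?A \<inter> ?B)"
      using card_translate[OF abc(1) C] card_translate[OF abc(2) C] by simp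
    moreover have "card (?A \<inter> ?B) \<le> card {x \<in> C. x \<oplus> w \<in> C}"
    proof -
      have "?A \<inter> ?B \<subseteq> (\<oplus>) a ` {x \<in> C. x \<oplus> w \<in> C}"
      proof
        fix y assume y: "y \<in> ?A \<inter> ?B"
        then obtain x x' where x: "y = a \<oplus> x" "y = b \<oplus> x'" "x \<in> C" "x' \<in> C" by blast
        have "x \<oplus> w = b \<oplus> (a \<oplus> x)" by (simp add: ab bxor_ac)
        also have "\<dots> = x'" using x abc C bxor_cancel by (metis subsetD)
        finally show "y \<in> (\<oplus>) a ` {x \<in> C. x \<oplus> w \<in> C}" using x by auto
      qed
      then have "card (?A \<inter> ?B) \<le> card ((\<oplus>) a ` {x \<in> C. x \<oplus> w \<in> C})"
        using finC by (intro card_mono) auto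
      also have "\<dots> = card {x \<in> C. x \<oplus> w \<in> C}"
        using C by (intro card_translate[OF abc(1)]) auto
      finally show ?thesis .
    qed
    ultimately show ?thesis using DC by linarith
  qed
  have "w \<oplus> w' \<in> G" if w: "w \<in> G" "w' \<in> G" for w w'
  proof -
    let ?A = "{x \<in> C. x \<oplus> w \<in> C}" and ?B = "{x \<in> C. x \<oplus> w' \<in> C}"
    have "card ?A + card ?B = card (?A \<union> ?B) + card (?A \<inter> ?B)"
      using finC by (intro card_Un_Int) auto
    moreover have "card (?A \<union> ?B) \<le> card C" using finC by (intro card_mono) auto
    ultimately have "0 < card (?A \<inter> ?B)"
      using popC[OF w(1)] popC[OF w(2)] N DC u by linarith
    then obtain x where x: "x \<in> C" "x \<oplus> w \<in> C" "x \<oplus> w' \<in> C"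
      by (metis (no_types, lifting) IntE card.empty ex_in_conv less_irrefl mem_Collect_eq)
    have "(x \<oplus> w) \<oplus> (x \<oplus> w') = x \<oplus> (x \<oplus> (w \<oplus> w'))" by (simp add: bxor_ac)
    also have "\<dots> = w \<oplus> w'" using x w C GD D by (intro bxor_cancel bxor_in_cube) auto
    finally show ?thesis using GI[OF x(2,3)] by simp
  qed
  moreover have "zeros n \<in> G" using GI[OF cC(1) cC(1)] bxor_self[OF cC(2)] by simp
  ultimately have "subspace_of_cube n G" using GD D by (auto simp: subspace_of_cube_def)
  moreover have "2 ^ n < 8 * card G"
  proof -
    \<comment> \<open>One translate of \<open>C\<close> already suffices, since
      \<open>2 * card C + u\<close> is at least \<open>2 ^ n\<close>.\<close>
    have "(\<oplus>) c ` C \<subseteq> G" using cC by (auto simp: G_def)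
    then have "card C \<le> card G"
      using card_translate[OF cC(2) C] card_mono[of G] finite_subset[OF GD finD] by metis
    then show ?thesis using N DC u by linarith
  qed
  ultimately show ?thesis using GD by blast
qed

text \<open>Any two of the four points differ by \<open>a\<close>, \<open>b\<close> or
  \<open>a \<oplus> b\<close>, none of them in \<open>D\<close>, so their colours are distinct and
  exhaust the four elements of \<open>cube 2\<close>.\<close>

lemma klein_coset_hits_colour:
  assumes h: "\<And>x. x \<in> cube n \<Longrightarrow> h x \<in> cube 2"
    and same: "\<And>x y. x \<in> cube n \<Longrightarrow> y \<in> cube n \<Longrightarrow> h x = h y \<Longrightarrow> x \<oplus> y \<in> D"
    and a: "a \<in> cube n" "a \<notin> D" and b: "b \<in> cube n" "b \<notin> D" and ab: "a \<oplus> b \<notin> D"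
    and x: "x \<in> cube n" and k: "k \<in> cube 2"
  shows "h x = k \<or> h (x \<oplus> a) = k \<or> h (x \<oplus> b) = k \<or> h (x \<oplus> (a \<oplus> b)) = k"
proof -
  have neq: "h y \<noteq> h (y \<oplus> d)" if "y \<in> cube n" "d \<in> cube n" "d \<notin> D" for y d
    using same[of y "y \<oplus> d"] that bxor_cancel by auto
  have e1: "(x \<oplus> a) \<oplus> (a \<oplus> b) = x \<oplus> b" "(x \<oplus> a) \<oplus> b = x \<oplus> (a \<oplus> b)"
    using a b x by (metis bxor_assoc bxor_cancel, simp add: bxor_assoc)
  have e2: "(x \<oplus> b) \<oplus> a = x \<oplus> (a \<oplus> b)"
    by (simp add: bxor_ac)
  let ?S = "{h x, h (x \<oplus> a), h (x \<oplus> b), h (x \<oplus> (a \<oplus> b))}"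
  have "h x \<noteq> h (x \<oplus> a)" "h x \<noteq> h (x \<oplus> b)" "h x \<noteq> h (x \<oplus> (a \<oplus> b))"
    "h (x \<oplus> a) \<noteq> h (x \<oplus> b)" "h (x \<oplus> a) \<noteq> h (x \<oplus> (a \<oplus> b))" "h (x \<oplus> b) \<noteq> h (x \<oplus> (a \<oplus> b))"
    using neq[of x a] neq[of x b] neq[of x "a \<oplus> b"] neq[of "x \<oplus> a" "a \<oplus> b"] neq[of "x \<oplus> a" b]
      neq[of "x \<oplus> b" a] a b x ab e1 e2 by auto
  then have "card ?S = card (cube 2)" by (simp add: card_cube)
  moreover have "?S \<subseteq> cube 2" using h a b x by auto
  ultimately have "?S = cube 2" by (intro card_subset_eq) auto
  then have "k \<in> ?S" using k by simp
  then show ?thesis by auto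
qed

lemma subspace_in_popular_set_triangle:
  assumes D: "D \<subseteq> cube n"
    and pop: "\<And>d. d \<in> cube n - D \<Longrightarrow> card {a \<in> D. a \<oplus> d \<in> D} \<le> u"
    and u: "8 * u < 2 ^ n"
    and h: "\<And>x. x \<in> cube n \<Longrightarrow> h x \<in> cube 2"
    and same: "\<And>x y. x \<in> cube n \<Longrightarrow> y \<in> cube n \<Longrightarrow> h x = h y \<Longrightarrow> x \<oplus> y \<in> D"
    and a: "a \<in> cube n" "a \<notin> D" and b: "b \<in> cube n" "b \<notin> D" and ab: "a \<oplus> b \<notin> D"
  shows "\<exists>G. subspace_of_cube n G \<and> G \<subseteq> D \<and> 2 ^ n < 8 * card G"
proof -
  define c where "c = a \<oplus> b"
  have c: "c \<in> cube n" "c \<notin> D" using a b ab by (auto simp: c_def)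
  have hits: "h x = k \<or> h (x \<oplus> a) = k \<or> h (x \<oplus> b) = k \<or> h (x \<oplus> c) = k"
    if "x \<in> cube n" "k \<in> cube 2" for x k
    unfolding c_def by (rule klein_coset_hits_colour[OF h same a b ab that])
  have abc: "a \<oplus> b = c" "b \<oplus> a = c" "a \<oplus> c = b" "c \<oplus> a = b" "b \<oplus> c = a" "c \<oplus> b = a"
    using a b bxor_cancel[of a n b] bxor_cancel[of b n a] by (simp_all add: c_def bxor_ac)
  have abcx: "a \<oplus> (b \<oplus> y) = c \<oplus> y" "b \<oplus> (a \<oplus> y) = c \<oplus> y" "a \<oplus> (c \<oplus> y) = b \<oplus> y"
    "c \<oplus> (a \<oplus> y) = b \<oplus> y" "b \<oplus> (c \<oplus> y) = a \<oplus> y" "c \<oplus> (b \<oplus> y) = a \<oplus> y" for y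
    by (simp_all add: abc flip: bxor_assoc)
  define R where "R d = {x \<in> D. d \<oplus> x \<in> D}" for d
  define Z where "Z = {z \<in> D. a \<oplus> z \<notin> D \<and> b \<oplus> z \<notin> D \<and> c \<oplus> z \<notin> D}"
  define H where "H = {z \<in> cube n. \<forall>x\<in>cube n. h (x \<oplus> z) = h x}"
  \<comment> \<open>Choosing the colour class that contains the zero string makes the class itself a
    subset of \<open>D\<close>: each of its points is its own difference from zero.\<close>
  define A where "A = {x \<in> cube n. h x = h (zeros n)}"
  have H: "subspace_of_cube n H"
    unfolding subspace_of_cube_def H_def by (auto simp: bxor_zeros simp flip: bxor_assoc)
  have HA: "x \<oplus> y \<in> A" if "x \<in> A" "y \<in> H" for x y
    using that by (auto simp: A_def H_def)
  have AD: "x \<oplus> y \<in> D" if "x \<in> A" "y \<in> A" for x y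
    using that same by (auto simp: A_def)
  have hitsA: "x \<in> A \<or> a \<oplus> x \<in> A \<or> b \<oplus> x \<in> A \<or> c \<oplus> x \<in> A" if x: "x \<in> cube n" for x
    using hits[OF x h[OF zeros_in_cube]] x a(1) b(1) c(1)
    by (simp add: A_def bxor_commute[of _ x])
  have zA: "zeros n \<in> A" by (simp add: A_def)
  have subD: "S \<subseteq> D" if "S \<subseteq> A" for S
  proof
    fix x assume "x \<in> S"
    then have "x \<in> A" using that by auto
    then have "zeros n \<oplus> x \<in> D" using AD zA by blast
    then show "x \<in> D" using \<open>x \<in> A\<close> bxor_zeros_left by (auto simp: A_def)
  qed
  have HsubA: "H \<subseteq> A"
    using HA[OF zA] bxor_zeros_left H by (auto simp: subspace_of_cube_def) (metis subsetD)
  \<comment> \<open>The coset of \<open>P\<close> through \<open>x \<oplus> z\<close> has a point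
    with the colour of \<open>x\<close>. Its other three points differ from \<open>x\<close> by
    \<open>a \<oplus> z\<close>, \<open>b \<oplus> z\<close> or \<open>c \<oplus> z\<close>, all
    outside \<open>D\<close>, so that point is \<open>x \<oplus> z\<close>.\<close>
  have "Z \<subseteq> H"
  proof
    fix z assume z: "z \<in> Z"
    then have zc: "z \<in> cube n" using D by (auto simp: Z_def)
    have "h (x \<oplus> z) = h x" if x: "x \<in> cube n" for x
    proof -
      have no: "h ((x \<oplus> z) \<oplus> p) \<noteq> h x" if p: "p \<in> cube n" "p \<oplus> z \<notin> D" for p
      proof
        assume "h ((x \<oplus> z) \<oplus> p) = h x"
        then have "x \<oplus> ((x \<oplus> z) \<oplus> p) \<in> D" using same x zc p by auto
        moreover have "x \<oplus> ((x \<oplus> z) \<oplus> p) = p \<oplus> z"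
          using x zc p by (simp add: bxor_assoc bxor_cancel bxor_commute[of p z])
        ultimately show False using p by simp
      qed
      have "h ((x \<oplus> z) \<oplus> a) \<noteq> h x" "h ((x \<oplus> z) \<oplus> b) \<noteq> h x" "h ((x \<oplus> z) \<oplus> c) \<noteq> h x"
        using no a(1) b(1) c(1) z by (simp_all add: Z_def)
      then show ?thesis using hits[OF bxor_in_cube[OF x zc] h[OF x]] by blast
    qed
    then show "z \<in> H" using zc by (simp add: H_def)
  qed
  then have "card Z \<le> card H" by (intro card_mono) (auto simp: H_def)
  have cardR: "card (R d) \<le> u" if "d \<in> cube n" "d \<notin> D" for d
    using pop[of d] that by (simp add: R_def bxor_commute[of d])
  have Rc: "R d \<subseteq> cube n" and Zc: "Z \<subseteq> cube n" and Ac: "A \<subseteq> cube n" for d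
    using D by (auto simp: R_def Z_def A_def)
  have fin: "finite (R d)" "finite Z" "finite A" for d
    using finite_subset[OF Rc] finite_subset[OF Zc] finite_subset[OF Ac] by auto
  \<comment> \<open>Every coset of \<open>P\<close> meets \<open>A\<close> and hence
    \<open>D\<close>. If it meets \<open>D\<close> once, translates of \<open>Z\<close> cover it. If
    two of its points in \<open>D\<close> differ by \<open>d\<close>, that pair lies in
    \<open>R d\<close>, and one translate of \<open>R d\<close> covers the other pair.\<close>
  have "cube n \<subseteq> (Z \<union> (\<oplus>) a ` Z \<union> (\<oplus>) b ` Z \<union> (\<oplus>) c ` Z) \<union>
      (R a \<union> (\<oplus>) b ` R a \<union> R b \<union> (\<oplus>) a ` R b \<union> R c \<union> (\<oplus>) a ` R c)" (is "_ \<subseteq> ?Zs \<union> ?Rs")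
  proof
    fix x assume x: "x \<in> cube n"
    have "x \<in> D \<or> a \<oplus> x \<in> D \<or> b \<oplus> x \<in> D \<or> c \<oplus> x \<in> D"
      using hitsA[OF x] subD[of A] by blast
    moreover have "x \<in> ?Zs \<union> ?Rs \<longleftrightarrow> x \<in> Z \<or> a \<oplus> x \<in> Z \<or> b \<oplus> x \<in> Z \<or> c \<oplus> x \<in> Z \<or>
        x \<in> R a \<or> b \<oplus> x \<in> R a \<or> x \<in> R b \<or> a \<oplus> x \<in> R b \<or> x \<in> R c \<or> a \<oplus> x \<in> R c"
      by (simp add: mem_translate_iff[OF a(1) _ x] mem_translate_iff[OF b(1) _ x]
          mem_translate_iff[OF c(1) _ x] Zc Rc)
    moreover have "a \<oplus> (a \<oplus> x) = x" "b \<oplus> (b \<oplus> x) = x" "c \<oplus> (c \<oplus> x) = x"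
      using bxor_cancel a b c x by auto
    ultimately show "x \<in> ?Zs \<union> ?Rs"
      by (simp add: Z_def R_def abcx) blast
  qed
  then have "card (cube n) \<le> card (?Zs \<union> ?Rs)"
    using fin by (intro card_mono) auto
  also have "\<dots> \<le> card Z + card ((\<oplus>) a ` Z) + card ((\<oplus>) b ` Z) + card ((\<oplus>) c ` Z) +
      (card (R a) + card ((\<oplus>) b ` R a) + card (R b) + card ((\<oplus>) a ` R b) + card (R c)
        + card ((\<oplus>) a ` R c))"
    by (intro order.trans[OF card_Un_le] add_mono order.refl)
  also have "\<dots> \<le> 4 * card Z + 6 * u"
    using card_translate[OF _ Zc] card_translate[OF _ Rc] a b c cardR[of a] cardR[of b] cardR[of c]
    by simp
  finally have "2 ^ n \<le> 4 * card Z + 6 * u" by (simp add: card_cube)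
  \<comment> \<open>Since \<open>8 * u < 2 ^ n\<close>, the term \<open>6 * u\<close> takes less
    than three quarters of the cube, which leaves more than a quarter for
    \<open>4 * card Z\<close>.\<close>
  then have bigH: "2 ^ n < 16 * card H" using \<open>card Z \<le> card H\<close> u by linarith
  show ?thesis
  proof (cases "2 ^ n < 8 * card H")
    case True
    then show ?thesis using H subD[OF HsubA] by blast
  next
    case False
    have "cube n \<subseteq> A \<union> (\<oplus>) a ` A \<union> (\<oplus>) b ` A \<union> (\<oplus>) c ` A"
    proof
      fix x assume x: "x \<in> cube n"
      show "x \<in> A \<union> (\<oplus>) a ` A \<union> (\<oplus>) b ` A \<union> (\<oplus>) c ` A"
        using hitsA[OF x] by (simp add: mem_translate_iff[OF a(1) Ac x]
          mem_translate_iff[OF b(1) Ac x] mem_translate_iff[OF c(1) Ac x])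
    qed
    then have "card (cube n) \<le> card (A \<union> (\<oplus>) a ` A \<union> (\<oplus>) b ` A \<union> (\<oplus>) c ` A)"
      using fin by (intro card_mono) auto
    also have "\<dots> \<le> card A + card ((\<oplus>) a ` A) + card ((\<oplus>) b ` A) + card ((\<oplus>) c ` A)"
      by (intro order.trans[OF card_Un_le] add_mono order.refl)
    also have "\<dots> = 4 * card A"
      using card_translate[OF _ Ac] a b c by simp
    finally have "2 ^ n \<le> 4 * card A" by (simp add: card_cube)
    \<comment> \<open>\<open>H\<close> has at most an eighth of the cube and \<open>A\<close> at
      least a quarter, so \<open>A\<close> has a point outside \<open>H\<close>. As \<open>A\<close>
      is invariant under \<open>H\<close>, it contains the whole coset of that point.\<close>
    then have "card H < card A" using False bigH by linarith
    then obtain v where v: "v \<in> A" "v \<notin> H"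
      by (metis HsubA subset_antisym subsetI less_irrefl)
    then have vc: "v \<in> cube n" by (simp add: A_def)
    let ?G = "H \<union> (\<oplus>) v ` H"
    have "?G \<subseteq> A" using HA v HsubA by auto
    then show ?thesis
      using subspace_of_cube_translate[OF H vc] card_subspace_translate[OF H vc v(2)] subD bigH
      by (intro exI[of _ ?G]) auto
  qed
qed

section \<open>Compatible shifts of a partial function\<close>

definition compatible_shifts :: "nat \<Rightarrow> (bool list \<Rightarrow> bool option) \<Rightarrow> bool list set" where
  "compatible_shifts n f = {d \<in> cube n. \<forall>z\<in>cube n.
     f z \<noteq> None \<longrightarrow> f (z \<oplus> d) \<noteq> None \<longrightarrow> f z = f (z \<oplus> d)}"

text \<open>Let \<open>z\<close> witness that \<open>d\<close> is incompatible. Were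
  \<open>f\<close> defined at \<open>z \<oplus> a\<close>, the compatible shifts \<open>a\<close>
  and \<open>a \<oplus> d\<close> would equate its value there with both \<open>f z\<close> and
  \<open>f (z \<oplus> d)\<close>. So translation by \<open>z\<close> injects these \<open>a\<close>
  into the undefined points.\<close>

lemma card_compatible_shifts_popular:
  assumes "d \<in> cube n - compatible_shifts n f"
  shows "card {a \<in> compatible_shifts n f. a \<oplus> d \<in> compatible_shifts n f}
    \<le> card {x \<in> cube n. f x = None}"
proof -
  obtain z where z: "z \<in> cube n" "f z \<noteq> None" "f (z \<oplus> d) \<noteq> None" "f z \<noteq> f (z \<oplus> d)"
    and d: "d \<in> cube n"
    using assms by (auto simp: compatible_shifts_def)
  let ?R = "{a \<in> compatible_shifts n f. a \<oplus> d \<in> compatible_shifts n f}"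
  have R: "?R \<subseteq> cube n" by (auto simp: compatible_shifts_def)
  have "f (z \<oplus> a) = None" if a: "a \<in> ?R" for a
  proof (rule ccontr)
    assume na: "f (z \<oplus> a) \<noteq> None"
    have ac: "a \<in> cube n" using a R by blast
    have "f z = f (z \<oplus> a)" using a z na by (auto simp: compatible_shifts_def)
    moreover have "f (z \<oplus> a) = f (z \<oplus> d)"
    proof -
      have e: "(z \<oplus> a) \<oplus> (a \<oplus> d) = z \<oplus> d"
        using ac d by (simp add: bxor_assoc bxor_cancel)
      have "\<forall>y\<in>cube n. f y \<noteq> None \<longrightarrow> f (y \<oplus> (a \<oplus> d)) \<noteq> None \<longrightarrow> f y = f (y \<oplus> (a \<oplus> d))"
        using a by (simp add: compatible_shifts_def)
      from bspec[OF this bxor_in_cube[OF z(1) ac]] show ?thesis using na z(3) e by simp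
    qed
    ultimately show False using z by simp
  qed
  then have "(\<oplus>) z ` ?R \<subseteq> {x \<in> cube n. f x = None}" using z R by auto
  then have "card ((\<oplus>) z ` ?R) \<le> card {x \<in> cube n. f x = None}"
    by (intro card_mono) auto
  then show ?thesis using card_translate[OF z(1) R] by simp
qed

lemma large_subspace_of_compatible_shifts:
  assumes u: "8 * card {x \<in> cube n. f x = None} < 2 ^ n"
    and h: "\<And>x. x \<in> cube n \<Longrightarrow> h x \<in> cube 2"
    and same: "\<And>x y. x \<in> cube n \<Longrightarrow> y \<in> cube n \<Longrightarrow> h x = h y \<Longrightarrow> x \<oplus> y \<in> compatible_shifts n f"
  shows "\<exists>G. subspace_of_cube n G \<and> G \<subseteq> compatible_shifts n f \<and> 2 ^ n < 8 * card G"
proof -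
  let ?D = "compatible_shifts n f"
  have D: "?D \<subseteq> cube n" by (auto simp: compatible_shifts_def)
  \<comment> \<open>An empty complement is split off because the sum-free case needs an element of
    it to translate by.\<close>
  consider (all) "?D = cube n"
    | (free) c where "c \<in> cube n - ?D" "\<And>a b. a \<in> cube n - ?D \<Longrightarrow> b \<in> cube n - ?D \<Longrightarrow> a \<oplus> b \<in> ?D"
    | (triangle) a b where "a \<in> cube n" "a \<notin> ?D" "b \<in> cube n" "b \<notin> ?D" "a \<oplus> b \<notin> ?D"
    using D by blast
  then show ?thesis
  proof cases
    case all
    then show ?thesis by (intro exI[of _ "cube n"]) (simp add: subspace_of_cube_def card_cube)
  next
    case free
    show ?thesis
      by (rule subspace_in_popular_set_triangle_free[OF D card_compatible_shifts_popular u free])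
  next
    case triangle
    show ?thesis
      by (rule subspace_in_popular_set_triangle[OF D card_compatible_shifts_popular u h same triangle])
  qed
qed

section \<open>Protocols, decision trees and the final comparison\<close>

text \<open>Parities are additive: the message consists of the parities of \<open>x\<close>, and the
  receiver adds those of \<open>y\<close>. This gives the lower bound on the tree depth.\<close>

lemma parity_nadt_imp_oneway_protocol:
  assumes F: "\<And>x y. x \<in> cube n \<Longrightarrow> y \<in> cube n \<Longrightarrow> F x y = f (x \<oplus> y)"
    and "parity_nadt n f p"
  shows "oneway_protocol n F p"
proof -
  obtain ss l where ss: "length ss = p" "set ss \<subseteq> cube n"
    and l: "\<forall>x\<in>cube n. f x \<noteq> None \<longrightarrow> Some (l (map (\<lambda>s. parity s x) ss)) = f x"
    using assms(2) by (auto simp: parity_nadt_def)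
  let ?h = "\<lambda>x. map (\<lambda>s. parity s x) ss"
  have "?h (x \<oplus> y) = ?h x \<oplus> ?h y" if "x \<in> cube n" "y \<in> cube n" for x y
    using ss(2)
  proof (induction ss)
    case Nil
    then show ?case by (simp add: bxor_def)
  next
    case (Cons s ss)
    then show ?case using that parity_bxor[of s n x y] by (auto simp: bxor_def)
  qed
  moreover have "?h ` cube n \<subseteq> cube p" using ss(1) by (auto simp: cube_def)
  ultimately show ?thesis
    unfolding oneway_protocol_def
    by (intro exI[of _ ?h] exI[of _ "\<lambda>m y. l (m \<oplus> ?h y)"]) (use l F in auto)
qed

text \<open>Sending the whole input shows that some length works, so the minimum in
  \<open>Dcc_oneway\<close> is attained.\<close>

lemma oneway_protocol_trivial: "oneway_protocol n F n"
  unfolding oneway_protocol_def by (intro exI[of _ "\<lambda>x. x"] exI[of _ "\<lambda>x y. the (F x y)"]) auto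

theorem theorem33:
  fixes n :: nat
    and f :: "bool list \<Rightarrow> bool option"
    and F :: "bool list \<Rightarrow> bool list \<Rightarrow> bool option"
  assumes "\<And>x y. x \<in> cube n \<Longrightarrow> y \<in> cube n \<Longrightarrow> F x y = f (x \<oplus> y)"
    and "real (card {x \<in> cube n. f x = None}) < 2 powi (int n - 3)"
    and "Dcc_oneway n F = 2"
  shows "NADT_parity n f = 2"
proof -
  let ?D = "compatible_shifts n f"
  \<comment> \<open>For \<open>n < 3\<close> the exponent is negative; clearing the factor 8 gives
    an inequality of naturals for every \<open>n\<close>.\<close>
  have "(2::real) powi (int n - 3) = 2 ^ n / 8"
    by (simp add: power_int_diff)
  then have "real (8 * card {x \<in> cube n. f x = None}) < real (2 ^ n)"
    using assms(2) by simp
  then have u: "8 * card {x \<in> cube n. f x = None} < 2 ^ n"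
    by (simp only: of_nat_less_iff)
  have "oneway_protocol n F 2"
    using LeastI[of "oneway_protocol n F", OF oneway_protocol_trivial] assms(3)
    by (simp add: Dcc_oneway_def)
  then obtain h \<phi> where h: "h ` cube n \<subseteq> cube 2"
    and \<phi>: "\<forall>x\<in>cube n. \<forall>y\<in>cube n. F x y \<noteq> None \<longrightarrow> Some (\<phi> (h x) y) = F x y"
    by (auto simp: oneway_protocol_def)
  \<comment> \<open>Against the second input \<open>x \<oplus> z\<close>, the first inputs
    \<open>x\<close> and \<open>y\<close> ask for \<open>f z\<close> and
    \<open>f (z \<oplus> (x \<oplus> y))\<close>; equal messages force equal answers.\<close>
  have same: "x \<oplus> y \<in> ?D" if xy: "x \<in> cube n" "y \<in> cube n" "h x = h y" for x y
  proof -
    have "f z = f (z \<oplus> (x \<oplus> y))"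
      if z: "z \<in> cube n" "f z \<noteq> None" "f (z \<oplus> (x \<oplus> y)) \<noteq> None" for z
    proof -
      have 1: "F x (x \<oplus> z) = f z" using assms(1) xy z bxor_cancel by auto
      have 2: "F y (x \<oplus> z) = f (z \<oplus> (x \<oplus> y))" using assms(1) xy z by (simp add: bxor_ac)
      have "Some (\<phi> (h x) (x \<oplus> z)) = f z"
        using \<phi> xy z 1 by (metis bxor_in_cube)
      moreover have "Some (\<phi> (h y) (x \<oplus> z)) = f (z \<oplus> (x \<oplus> y))"
        using \<phi> xy z 2 by (metis bxor_in_cube)
      ultimately show ?thesis using xy by simp
    qed
    then show ?thesis using xy by (auto simp: compatible_shifts_def)
  qed
  obtain G where G: "subspace_of_cube n G" "G \<subseteq> ?D" "2 ^ n < 8 * card G"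
    using large_subspace_of_compatible_shifts[OF u, of h] h same by blast
  obtain s t where st: "s \<in> cube n" "t \<in> cube n"
    and ker: "\<And>x. x \<in> cube n \<Longrightarrow> \<not> parity s x \<Longrightarrow> \<not> parity t x \<Longrightarrow> x \<in> G"
    using two_parities_kernel_subset[OF G(1,3)] by blast
  let ?m = "\<lambda>x. map (\<lambda>s. parity s x) [s, t]"
  have const: "f x = f y"
    if xy: "x \<in> cube n" "y \<in> cube n" "f x \<noteq> None" "f y \<noteq> None" "?m x = ?m y" for x y
  proof -
    have "x \<oplus> y \<in> ?D"
      using ker[of "x \<oplus> y"] xy st G(2) by (auto simp: parity_bxor)
    then show ?thesis
      using xy bxor_cancel[of x n y] unfolding compatible_shifts_def by auto
  qed
  \<comment> \<open>The value is read off at any defined point with parities \<open>m\<close>, the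
    choice being harmless by \<open>const\<close>. If there is no such point, \<open>l m\<close> is
    arbitrary.\<close>
  define l where "l m = the (f (SOME x. x \<in> cube n \<and> f x \<noteq> None \<and> ?m x = m))" for m
  have "Some (l (?m x)) = f x" if x: "x \<in> cube n" "f x \<noteq> None" for x
  proof -
    let ?y = "SOME y. y \<in> cube n \<and> f y \<noteq> None \<and> ?m y = ?m x"
    have "?y \<in> cube n \<and> f ?y \<noteq> None \<and> ?m ?y = ?m x"
      by (rule someI[of _ x]) (use x in auto)
    then have "f ?y = f x" using const x by blast
    moreover have "l (?m x) = the (f ?y)" by (simp only: l_def)
    ultimately show ?thesis using x by simp
  qed
  then have two: "parity_nadt n f 2"
    unfolding parity_nadt_def using st by (intro exI[of _ "[s, t]"] exI[of _ l]) auto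
  \<comment> \<open>A shallower tree would yield a protocol shorter than the minimum 2.\<close>
  have "2 \<le> p" if "parity_nadt n f p" for p
    using Least_le[of "oneway_protocol n F", OF parity_nadt_imp_oneway_protocol[OF assms(1) that]]
      assms(3) by (simp add: Dcc_oneway_def)
  then show ?thesis unfolding NADT_parity_def using two by (intro Least_equality) auto
qed

end
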